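(* Let $(\Omega,\mathcal{B},\mu)$ be a $\sigma$-finite measure space with $\mu(\Omega)=\infty$, and let $T:\Omega\to\Omega$ be a conservative, invertible, ergodic, measure-preserving transformation. For large enough $M>0$, there exist bounded measurable functions (sampling functions) $f:\Omega\to\mathbb{R}$ such that the corresponding upper and lower Lyapunov exponents satisfy $\overline{L}^+(E)>\underline{L}^+(E)$ when $|E|>M$.
   Context: A measurable transformation $T$ is: invertible if it is bijective and $T^{-1}$ is measurable; measure-preserving if $\mu(T^{-1}B)=\mu(B)$ for all $B\in\mathcal{B}$; ergodic if $T^{-1}B=B$ (with $B\in\mathcal{B}$) implies $\mu(B)=0$ or $\mu(\Omega\setminus B)=0$; conservative if there is no $W\in\mathcal{B}$ with $\mu(W)>0$ such that the sets $T^{-n}W$, $n\ge 0$, are disjoint. Given $f$ and $E\in\mathbb{C}$, let $A(E,\omega)=\begin{pmatrix}E-f(\omega)&-1\\1&0\end{pmatrix}$ and $A(E,n,\omega)=A(E,T^{n-1}\omega)\cdots A(E,\omega)$ for $n>0$. For each $E\in\mathbb{C}$, $\overline{L}^+(E)$ and $\underline{L}^+(E)$ are the finite constants (which exist) such that, for $\mu$-a.e. $\omega$, $\limsup_{n\to+\infty}\frac1n\log\|A(E,n,\omega)\|=\overline{L}^+(E)$ and $\liminf_{n\to+\infty}\frac1n\log\|A(E,n,\omega)\|=\underline{L}^+(E)$. *)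

theory Defs
  imports "HOL-Analysis.Analysis"
begin

definition invertible_transformation :: "'a measure \<Rightarrow> ('a \<Rightarrow> 'a) \<Rightarrow> bool" where
  "invertible_transformation M T \<longleftrightarrow>
     T \<in> measurable M M \<and>
     bij_betw T (space M) (space M) \<and>
     the_inv_into (space M) T \<in> measurable M M"

definition measure_preserving_transformation :: "'a measure \<Rightarrow> ('a \<Rightarrow> 'a) \<Rightarrow> bool" where
  "measure_preserving_transformation M T \<longleftrightarrow>
     T \<in> measurable M M \<and>
     (\<forall>B\<in>sets M. emeasure M (T -` B \<inter> space M) = emeasure M B)"

definition ergodic_transformation :: "'a measure \<Rightarrow> ('a \<Rightarrow> 'a) \<Rightarrow> bool" where
  "ergodic_transformation M T \<longleftrightarrow>
     T \<in> measurable M M \<and>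
     (\<forall>B\<in>sets M. T -` B \<inter> space M = B \<longrightarrow>
        emeasure M B = 0 \<or> emeasure M (space M - B) = 0)"

definition conservative_transformation :: "'a measure \<Rightarrow> ('a \<Rightarrow> 'a) \<Rightarrow> bool" where
  "conservative_transformation M T \<longleftrightarrow>
     T \<in> measurable M M \<and>
     \<not> (\<exists>W\<in>sets M. emeasure M W > 0 \<and>
          disjoint_family (\<lambda>n::nat. (T ^^ n) -` W \<inter> space M))"

definition transfer_matrix :: "('a \<Rightarrow> real) \<Rightarrow> complex \<Rightarrow> 'a \<Rightarrow> complex^2^2" where
  "transfer_matrix f E x =
     vector [vector [E - complex_of_real (f x), -1],
             vector [1, 0]]"

primrec transfer_cocycle ::
    "('a \<Rightarrow> 'a) \<Rightarrow> ('a \<Rightarrow> real) \<Rightarrow> complex \<Rightarrow> nat \<Rightarrow> 'a \<Rightarrow> complex^2^2" where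
  "transfer_cocycle T f E 0 x = mat 1"
| "transfer_cocycle T f E (Suc n) x =
     transfer_matrix f E ((T ^^ n) x) ** transfer_cocycle T f E n x"

text \<open>The norm of a matrix is its operator norm with respect to the Hermitian norm
  on \<^typ>\<open>complex^2\<close>. The term with index 0 below is \<open>0\<close> and is irrelevant for the limits.\<close>

definition log_growth_rate ::
    "('a \<Rightarrow> 'a) \<Rightarrow> ('a \<Rightarrow> real) \<Rightarrow> complex \<Rightarrow> 'a \<Rightarrow> nat \<Rightarrow> real" where
  "log_growth_rate T f E x n =
     1 / real n * ln (onorm (\<lambda>v. transfer_cocycle T f E n x *v v))"

text \<open>The exponents are introduced as relations because they are characterised by an
  almost-everywhere condition; the value is a real number, hence finite, and it is unique
  whenever the space is not a null set.\<close>

definition is_upper_Lyapunov_exponent ::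
    "'a measure \<Rightarrow> ('a \<Rightarrow> 'a) \<Rightarrow> ('a \<Rightarrow> real) \<Rightarrow> complex \<Rightarrow> real \<Rightarrow> bool" where
  "is_upper_Lyapunov_exponent M T f E L \<longleftrightarrow>
     (AE x in M. limsup (\<lambda>n. ereal (log_growth_rate T f E x n)) = ereal L)"

definition is_lower_Lyapunov_exponent ::
    "'a measure \<Rightarrow> ('a \<Rightarrow> 'a) \<Rightarrow> ('a \<Rightarrow> real) \<Rightarrow> complex \<Rightarrow> real \<Rightarrow> bool" where
  "is_lower_Lyapunov_exponent M T f E L \<longleftrightarrow>
     (AE x in M. liminf (\<lambda>n. ereal (log_growth_rate T f E x n)) = ereal L)"

end

theory Submission
  imports Defs
begin

text \<open>
  A set of finite measure is visited with density zero by almost every orbit, because the maximal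
  inequality would otherwise bound \<open>\<mu>(\<Omega>)\<close>. Exhaust \<open>\<Omega>\<close> by rapidly growing sets \<open>B\<^sub>0 \<subset> B\<^sub>1 \<subset> \<dots>\<close> of
  finite measure and let \<open>f\<close> be \<open>k mod 3\<close> on \<open>B\<^sub>k - B\<^sub>k\<^sub>-\<^sub>1\<close>. If \<open>B\<^sub>k\<^sub>+\<^sub>1\<close> is chosen large enough after
  a time \<open>\<tau>\<^sub>k\<close>, almost every orbit spends nearly all of its first \<open>\<tau>\<^sub>k\<close> steps in \<open>B\<^sub>k\<^sub>+\<^sub>1 - B\<^sub>k\<close>, for all
  large \<open>k\<close>. For \<open>|E| > 5\<close> the cocycle is uniformly hyperbolic, so along these times the growth rate
  is close to that of a constant potential \<open>c\<close>, namely \<open>ln |\<rho>\<^sub>c|\<close> with \<open>\<rho>\<^sub>c + 1/\<rho>\<^sub>c = E - c\<close> and \<open>|\<rho>\<^sub>c| > 1\<close>,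
  and each \<open>c \<in> {0, 1, 2}\<close> occurs infinitely often. The three numbers \<open>|\<rho>\<^sub>c|\<close> cannot all agree:
  otherwise \<open>E\<close>, \<open>E - 1\<close>, \<open>E - 2\<close> would be three points of a horizontal line on one ellipse.
\<close>

section \<open>Continuants and the transfer cocycle\<close>

text \<open>For positive n, \<open>continuant z n\<close> is the determinant of the n by n
  tridiagonal matrix with diagonal \<open>z 0\<close>, ..., \<open>z (n - 1)\<close> and
  neighbouring entries 1. It reduces matrix products to a scalar recurrence.\<close>

fun continuant :: "(nat \<Rightarrow> complex) \<Rightarrow> nat \<Rightarrow> complex" where
  "continuant z 0 = 1"
| "continuant z (Suc 0) = z 0"
| "continuant z (Suc (Suc n)) = z (Suc n) * continuant z (Suc n) - continuant z n"

text \<open>Expansion at the first row instead of the last: in n both sides obey the same three-term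
  recurrence. This form links the orbit of \<open>T x\<close> to that of x.\<close>

lemma continuant_left:
  "continuant z (Suc (Suc n)) =
     z 0 * continuant (\<lambda>k. z (Suc k)) (Suc n) - continuant (\<lambda>k. z (Suc (Suc k))) n"
proof (induction n rule: less_induct)
  case (less n)
  consider "n = 0" | "n = 1" | m where "n = Suc (Suc m)"
    by (metis One_nat_def not0_implies_Suc)
  then show ?case
  proof cases
    case 3
    have IH: "continuant z (Suc (Suc k)) =
      z 0 * continuant (\<lambda>k. z (Suc k)) (Suc k) - continuant (\<lambda>k. z (Suc (Suc k))) k"
      if "k < Suc (Suc m)" for k
      using less.IH that 3 by blast
    let ?b = "continuant (\<lambda>k. z (Suc k))" and ?c = "continuant (\<lambda>k. z (Suc (Suc k)))"
      and ?w = "z (Suc (Suc (Suc m)))"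
    have "continuant z (Suc (Suc (Suc (Suc m)))) =
        ?w * continuant z (Suc (Suc (Suc m))) - continuant z (Suc (Suc m))"
      by (rule continuant.simps)
    also have "\<dots> = ?w * (z 0 * ?b (Suc (Suc m)) - ?c (Suc m)) - (z 0 * ?b (Suc m) - ?c m)"
      using IH[of "Suc m"] IH[of m] by (simp del: continuant.simps)
    also have "\<dots> = z 0 * (?w * ?b (Suc (Suc m)) - ?b (Suc m)) - (?w * ?c (Suc m) - ?c m)"
      by (simp only: algebra_simps)
    finally show ?thesis
      unfolding 3 continuant.simps(3)[of _ "Suc m"] continuant.simps(3)[of _ m] .
  qed (auto simp: algebra_simps)
qed

text \<open>The products start at length two because the lower right entry is a continuant two
  shorter; length one would call for a continuant of length -1.\<close>

lemma transfer_cocycle_continuant: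
  fixes T :: "'a \<Rightarrow> 'a" and f :: "'a \<Rightarrow> real" and E :: complex and x :: 'a
  defines "z \<equiv> \<lambda>k. E - complex_of_real (f ((T ^^ k) x))"
  shows "transfer_cocycle T f E (Suc (Suc n)) x =
    vector [vector [continuant z (Suc (Suc n)), - continuant (\<lambda>k. z (Suc k)) (Suc n)],
            vector [continuant z (Suc n), - continuant (\<lambda>k. z (Suc k)) n]]"
proof (induction n)
  case 0
  then show ?case
    by (simp add: z_def transfer_matrix_def vec_eq_iff forall_2 matrix_matrix_mult_def sum_2 mat_def)
next
  case (Suc n)
  have "transfer_cocycle T f E (Suc (Suc (Suc n))) x =
    transfer_matrix f E ((T ^^ (Suc (Suc n))) x) ** transfer_cocycle T f E (Suc (Suc n)) x"
    by (rule transfer_cocycle.simps)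
  then show ?case unfolding Suc.IH
    by (simp add: transfer_matrix_def vec_eq_iff forall_2 matrix_matrix_mult_def sum_2
        del: transfer_cocycle.simps) (simp add: z_def algebra_simps)
qed

text \<open>If the previous term is at most half of the current one, the next step multiplies the
  modulus by at least 3 - 1/2, which restores the ratio 2.\<close>

lemma continuant_growth:
  assumes "\<And>k. 3 \<le> cmod (z k)"
  shows "2 * cmod (continuant z n) \<le> cmod (continuant z (Suc n))"
    and "1 \<le> cmod (continuant z n)"
proof -
  have *: "1 \<le> cmod (continuant z n) \<and> 2 * cmod (continuant z n) \<le> cmod (continuant z (Suc n))" for n
  proof (induction n)
    case 0
    then show ?case using assms[of 0] by simp
  next
    case (Suc n)
    have "3 * cmod (continuant z (Suc n)) \<le> cmod (z (Suc n) * continuant z (Suc n))"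
      unfolding norm_mult using assms by (intro mult_right_mono) auto
    then show ?case
      using Suc norm_triangle_ineq2[of "z (Suc n) * continuant z (Suc n)" "continuant z n"] by simp
  qed
  show "2 * cmod (continuant z n) \<le> cmod (continuant z (Suc n))"
    and "1 \<le> cmod (continuant z n)" using * by auto
qed

lemma continuant_shift_growth_lower:
  assumes "\<And>k. 3 \<le> cmod (z k)"
  shows "2 * cmod (continuant (\<lambda>k. z (Suc k)) n) \<le> cmod (continuant z (Suc n))"
  using assms
proof (induction n arbitrary: z)
  case 0
  show ?case using "0"[of 0] by simp
next
  case (Suc n)
  let ?c = "continuant (\<lambda>k. z (Suc k)) (Suc n)" and ?d = "continuant (\<lambda>k. z (Suc (Suc k))) n"
  have "2 * cmod ?d \<le> cmod ?c"
    using Suc.prems by (intro Suc.IH)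
  moreover have "3 * cmod ?c \<le> cmod (z 0 * ?c)"
    unfolding norm_mult using Suc.prems by (intro mult_right_mono) auto
  ultimately show "2 * cmod ?c \<le> cmod (continuant z (Suc (Suc n)))"
    unfolding continuant_left
    using norm_triangle_ineq2[of "z 0 * ?c" ?d] norm_ge_zero[of ?c] norm_ge_zero[of ?d] by linarith
qed

text \<open>With the preceding lower bound, dropping the first letter changes the modulus by a
  factor between 2 and \<open>K + 1\<close>. This is why growth rates are invariant under
  \<open>T\<close>.\<close>

lemma continuant_shift_growth_upper:
  assumes "\<And>k. 3 \<le> cmod (z k)" "\<And>k. cmod (z k) \<le> K"
  shows "cmod (continuant z (Suc n)) \<le> (K + 1) * cmod (continuant (\<lambda>k. z (Suc k)) n)"
proof (cases n)
  case 0
  then show ?thesis using assms(2)[of 0] by simp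
next
  case (Suc m)
  let ?c = "continuant (\<lambda>k. z (Suc k)) (Suc m)" and ?d = "continuant (\<lambda>k. z (Suc (Suc k))) m"
  have "2 * cmod ?d \<le> cmod ?c"
    using assms(1) by (intro continuant_shift_growth_lower)
  moreover have "cmod (z 0 * ?c) \<le> K * cmod ?c"
    unfolding norm_mult using assms(2) by (intro mult_right_mono) auto
  ultimately have "cmod (z 0 * ?c - ?d) \<le> K * cmod ?c + cmod ?c"
    using norm_triangle_ineq4[of "z 0 * ?c" ?d] norm_ge_zero[of ?d] by linarith
  then show ?thesis
    unfolding Suc continuant_left by (simp only: distrib_right mult_1)
qed

text \<open>The lower bound evaluates at the first basis vector. The crude factor 4 disappears after
  taking logarithms and dividing by n.\<close>

lemma onorm_matrix_vector_2_bounds: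
  fixes A :: "complex^2^2"
  shows "cmod (A $ 1 $ 1) \<le> onorm ((*v) A)"
    and "(\<And>i j. cmod (A $ i $ j) \<le> p) \<Longrightarrow> onorm ((*v) A) \<le> 4 * p"
proof -
  have "linear ((*v) A)"
  proof (rule linearI)
    show "A *v (x + y) = A *v x + A *v y" for x y
      by (rule matrix_vector_right_distrib)
    show "A *v (r *\<^sub>R x) = r *\<^sub>R (A *v x)" for r x
      by (simp add: vec_eq_iff matrix_vector_mult_def scaleR_sum_right)
  qed
  then have bl: "bounded_linear ((*v) A)"
    by (simp add: linear_conv_bounded_linear)
  have "cmod (A $ 1 $ 1) = cmod ((A *v axis 1 1) $ 1)"
    by (simp add: matrix_vector_mult_def sum_2 axis_def)
  also have "\<dots> \<le> norm (A *v axis 1 1)"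
    by (rule Finite_Cartesian_Product.norm_nth_le)
  also have "\<dots> \<le> onorm ((*v) A) * norm (axis 1 (1::complex) :: complex^2)"
    by (rule onorm[OF bl])
  finally show "cmod (A $ 1 $ 1) \<le> onorm ((*v) A)"
    by (simp add: norm_axis_1)
  show "onorm ((*v) A) \<le> 4 * p" if p: "\<And>i j. cmod (A $ i $ j) \<le> p"
  proof (rule onorm_le)
    fix v :: "complex^2"
    have p0: "0 \<le> p" using p[of 1 1] norm_ge_zero order_trans by blast
    have comp: "cmod ((A *v v) $ i) \<le> 2 * p * norm v" for i
    proof -
      have *: "cmod (A $ i $ j * v $ j) \<le> p * norm v" for j
        unfolding norm_mult using p p0 Finite_Cartesian_Product.norm_nth_le by (intro mult_mono) auto
      have "cmod ((A *v v) $ i) \<le> cmod (A $ i $ 1 * v $ 1) + cmod (A $ i $ 2 * v $ 2)"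
        by (simp add: matrix_vector_mult_def sum_2 norm_triangle_ineq)
      then show ?thesis using *[of 1] *[of 2] by simp
    qed
    have "norm (A *v v) \<le> (\<Sum>i\<in>UNIV. cmod ((A *v v) $ i))"
      unfolding norm_vec_def by (rule L2_set_le_sum) simp
    then show "norm (A *v v) \<le> 4 * p * norm v"
      using comp[of 1] comp[of 2] by (simp add: sum_2)
  qed
qed

section \<open>Comparison with a constant potential\<close>

lemma abs_ln_diff_le:
  fixes a b :: real
  assumes "1 \<le> a" "1 \<le> b"
  shows "\<bar>ln a - ln b\<bar> \<le> \<bar>a - b\<bar>"
proof -
  have *: "ln a - ln b \<le> \<bar>a - b\<bar>" if "1 \<le> a" "1 \<le> b" for a b :: real
  proof -
    have "ln a - ln b = ln (a / b)"
      using that by (simp add: ln_div)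
    also have "a / b = 1 + (a - b) / b"
      using that by (simp add: field_simps)
    also have "ln (1 + (a - b) / b) \<le> (a - b) / b"
      using that by (intro ln_add_one_self_le_self2) (auto simp: field_simps)
    also have "\<dots> \<le> \<bar>a - b\<bar> / 1"
      using that by (intro frac_le) auto
    finally show ?thesis by simp
  qed
  show ?thesis using *[OF assms] *[OF assms(2,1)] by (simp add: abs_le_iff)
qed

text \<open>The candidates are the two roots of t^2 - w t + 1. Their product is 1, so one has
  modulus at least 1; the other then contributes at most 1 to a sum of modulus at least 3.\<close>

lemma exists_expanding_root:
  fixes w :: complex
  assumes "3 \<le> cmod w"
  obtains \<rho> where "\<rho> + 1 / \<rho> = w" "2 \<le> cmod \<rho>"
proof -
  define s where "s = csqrt (w\<^sup>2 - 4)"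
  define a where "a = (w + s) / 2"
  define b where "b = (w - s) / 2"
  have "s * s = w\<^sup>2 - 4"
    unfolding s_def by (metis power2_csqrt power2_eq_square)
  then have ab: "a * b = 1" "a + b = w"
    by (auto simp: a_def b_def field_simps power2_eq_square)
  have big: "\<exists>\<rho>. \<rho> + 1 / \<rho> = w \<and> 2 \<le> cmod \<rho>" if "a * b = 1" "a + b = w" "1 \<le> cmod a" for a b
  proof -
    have b: "b = 1 / a" using that(1) by (metis nonzero_mult_div_cancel_left mult_zero_left zero_neq_one)
    have "cmod b \<le> 1" using that(3) unfolding b by (simp add: norm_divide divide_simps)
    moreover have "cmod w \<le> cmod a + cmod b" using that(2) norm_triangle_ineq[of a b] by simp
    ultimately show ?thesis using assms that(2) b by (intro exI[of _ a]) auto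
  qed
  have "cmod a * cmod b = 1" using ab(1) by (metis norm_mult norm_one)
  then have "1 \<le> cmod a \<or> 1 \<le> cmod b"
    using mult_strict_mono'[of "cmod a" 1 "cmod b" 1] by fastforce
  then show ?thesis
  proof
    assume "1 \<le> cmod a"
    from big[OF ab this] show ?thesis using that by blast
  next
    assume "1 \<le> cmod b"
    moreover have "b * a = 1" "b + a = w"
      using ab by (simp_all add: mult.commute add.commute)
    ultimately show ?thesis using big that by blast
  qed
qed

text \<open>On a circle of radius R, inversion is conjugation scaled by \<open>q = 1 / R^2\<close>,
  so the root equation splits into (1 + q) times the real part and (1 - q) times the imaginary part.
  The imaginary parts then coincide and the real parts agree up to sign; three values with two signs
  would make two of the numbers E - c equal.\<close>

lemma expanding_roots_not_all_equal:
  fixes E :: complex and \<rho> :: "nat \<Rightarrow> complex"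
  assumes root: "\<And>c. c < 3 \<Longrightarrow> \<rho> c + 1 / \<rho> c = E - of_nat c"
    and big: "\<And>c. c < 3 \<Longrightarrow> 2 \<le> cmod (\<rho> c)"
  shows "\<exists>c<3. \<exists>d<3. cmod (\<rho> c) < cmod (\<rho> d)"
proof (rule ccontr)
  assume neg: "\<not> ?thesis"
  define R where "R = cmod (\<rho> 0)"
  have R: "cmod (\<rho> c) = R" if "c < 3" for c
  proof -
    have "\<not> cmod (\<rho> c) < cmod (\<rho> 0)" "\<not> cmod (\<rho> 0) < cmod (\<rho> c)"
      using neg that zero_less_numeral by blast+
    then show ?thesis unfolding R_def by linarith
  qed
  have R2: "2 \<le> R" using big R_def by simp
  define q where "q = 1 / R\<^sup>2"
  have q: "q < 1" using R2 unfolding q_def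
    by (simp add: divide_simps)
  have inv: "1 / \<rho> c = of_real q * cnj (\<rho> c)" if "c < 3" for c
    using R[OF that] R2 unfolding q_def
    by (subst complex_div_cnj) simp
  have Imq: "Im (\<rho> c) * (1 - q) = Im E" if "c < 3" for c
    using arg_cong[OF root[OF that], of Im] inv[OF that] by (simp add: algebra_simps)
  have Req: "Re (\<rho> c) * (1 + q) = Re E - real c" if "c < 3" for c
    using arg_cong[OF root[OF that], of Re] inv[OF that] by (simp add: algebra_simps)
  have Im_eq: "Im (\<rho> c) = Im (\<rho> 0)" if "c < 3" for c
    using Imq[OF that] Imq[of 0] q mult_right_cancel[of "1 - q" "Im (\<rho> c)" "Im (\<rho> 0)"] by simp
  have "(Re (\<rho> c))\<^sup>2 = (Re (\<rho> 0))\<^sup>2" if "c < 3" for c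
    using cmod_power2[of "\<rho> c"] cmod_power2[of "\<rho> 0"] R[OF that] R[of 0] Im_eq[OF that] by simp
  then have "Re (\<rho> c) = Re (\<rho> 0) \<or> Re (\<rho> c) = - Re (\<rho> 0)" if "c < 3" for c
    using that power2_eq_iff by blast
  from this[of 1] this[of 2] Req[of 0] Req[of 1] Req[of 2] show False
    by auto
qed

text \<open>Ratios of consecutive continuants evolve by r -> z - 1/r, which contracts towards the
  fixed point \<open>\<rho>\<close> as long as z equals w. Hence each index with another z adds only
  a bounded amount to the total error.\<close>

lemma continuant_ln_growth:
  assumes z3: "\<And>k. 3 \<le> cmod (z k)" and zK: "\<And>k. cmod (z k) \<le> K"
    and root: "\<rho> + 1 / \<rho> = w" and \<rho>2: "2 \<le> cmod \<rho>" and wK: "cmod w \<le> K"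
  shows "\<bar>ln (cmod (continuant z n)) - real n * ln (cmod \<rho>)\<bar>
    \<le> 4 * (K + 1) * (1 + real (card {k. k < n \<and> z k \<noteq> w}))"
proof -
  define r where "r k = continuant z (Suc k) / continuant z k" for k
  define d where "d k = cmod (r k - \<rho>)" for k
  have nz: "continuant z k \<noteq> 0" for k
    using continuant_growth(2)[where z = z, OF z3, of k] by auto
  have r2: "2 \<le> cmod (r k)" for k
    unfolding r_def norm_divide
    using continuant_growth[where z = z, OF z3, of k] nz[of k] by (simp add: le_divide_eq)
  then have rnz: "r k \<noteq> 0" for k
    by (metis norm_zero not_numeral_le_zero)
  have \<rho>nz: "\<rho> \<noteq> 0" using \<rho>2 by auto
  have r_Suc: "r (Suc k) = z (Suc k) - 1 / r k" for k
    using nz[of k] nz[of "Suc k"] by (simp add: r_def diff_divide_distrib)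
  have inv_small: "cmod (1 / v) \<le> 1" if "2 \<le> cmod v" for v :: complex
    using that by (simp add: norm_divide divide_simps)
  have rK: "cmod (r k) \<le> K + 1" for k
  proof (cases k)
    case 0
    then show ?thesis using zK[of 0] by (simp add: r_def)
  next
    case (Suc m)
    then show ?thesis
      using norm_triangle_ineq4[of "z (Suc m)" "1 / r m"] zK[of "Suc m"] inv_small[OF r2[of m]]
      unfolding Suc r_Suc by linarith
  qed
  have \<rho>K: "cmod \<rho> \<le> K + 1"
  proof -
    have "\<rho> = w - 1 / \<rho>" using root by (simp add: algebra_simps)
    then have "cmod \<rho> \<le> cmod w + cmod (1 / \<rho>)"
      using norm_triangle_ineq4[of w "1 / \<rho>"] by simp
    then show ?thesis using wK inv_small[OF \<rho>2] by linarith
  qed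
  have dK: "d k \<le> 2 * (K + 1)" for k
    using norm_triangle_ineq4[of "r k" \<rho>] rK[of k] \<rho>K unfolding d_def by (simp add: algebra_simps)
  have d0: "0 \<le> d k" for k by (simp add: d_def)
  \<comment> \<open>Subtracting the fixed point equation leaves the factor 1 /
    (\<open>r k * \<rho>\<close>), of modulus at most 1/4; the weaker 1/2 suffices for
    summation.\<close>
  have contract: "2 * d (Suc k) \<le> d k" if "z (Suc k) = w" for k
  proof -
    have "r (Suc k) - \<rho> = (r k - \<rho>) / (r k * \<rho>)"
      unfolding r_Suc that root[symmetric] using rnz[of k] \<rho>nz by (auto simp: field_simps)
    then have "d (Suc k) = d k / (cmod (r k) * cmod \<rho>)"
      by (simp add: d_def norm_divide norm_mult)
    also have "\<dots> \<le> d k / (2 * 1)"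
      using r2[of k] \<rho>2 d0[of k] by (intro divide_left_mono mult_mono mult_pos_pos) (auto intro: less_le_trans[of 0 2])
    finally show ?thesis by simp
  qed
  define b where "b n = card {k. k < n \<and> z k \<noteq> w}" for n
  have b_Suc: "b (Suc n) = b n + (if z n = w then 0 else 1)" for n
  proof -
    have "{k. k < Suc n \<and> z k \<noteq> w} = {k. k < n \<and> z k \<noteq> w} \<union> (if z n = w then {} else {n})"
      by (auto simp: less_Suc_eq)
    then show ?thesis unfolding b_def by (auto simp: card_insert_if)
  qed
  \<comment> \<open>The extra \<open>d n\<close> closes the induction: at a good index
    \<open>2 * d (Suc n) \<le> d n\<close> pays for both new terms. At a bad index each is at most
    \<open>2 * (K + 1)\<close>, which gives the constant \<open>4 * (K + 1)\<close>, and the 1 on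
    the right covers \<open>d 0\<close>.\<close>
  have dsum: "(\<Sum>k\<le>n. d k) + d n \<le> 4 * (K + 1) * (1 + real (b (Suc n)))" for n
  proof (induction n)
    case 0
    have "4 * (K + 1) * 1 \<le> 4 * (K + 1) * (1 + real (b (Suc 0)))"
      using d0[of 0] dK[of 0] by (intro mult_left_mono) auto
    then show ?case using dK[of 0] by simp
  next
    case (Suc n)
    show ?case
    proof (cases "z (Suc n) = w")
      case True
      then show ?thesis using Suc contract[of n] by (simp add: b_Suc[of "Suc n"])
    next
      case False
      then have "4 * (K + 1) * (1 + real (b (Suc (Suc n)))) =
          4 * (K + 1) * (1 + real (b (Suc n))) + 4 * (K + 1)"
        by (simp add: b_Suc[of "Suc n"] algebra_simps)
      then show ?thesis using Suc dK[of "Suc n"] d0[of n] by simp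
    qed
  qed
  have "\<bar>ln (cmod (continuant z n)) - real n * ln (cmod \<rho>)\<bar> \<le> (\<Sum>k<n. d k)"
  proof (induction n)
    case (Suc n)
    have "continuant z (Suc n) = r n * continuant z n"
      using nz[of n] by (simp add: r_def)
    then have "ln (cmod (continuant z (Suc n))) = ln (cmod (r n)) + ln (cmod (continuant z n))"
      using nz[of n] rnz[of n] by (simp add: norm_mult ln_mult)
    moreover have "\<bar>ln (cmod (r n)) - ln (cmod \<rho>)\<bar> \<le> d n"
      using abs_ln_diff_le[of "cmod (r n)" "cmod \<rho>"] r2[of n] \<rho>2
        norm_triangle_ineq3[of "r n" \<rho>] unfolding d_def by linarith
    moreover have "real (Suc n) * ln (cmod \<rho>) = real n * ln (cmod \<rho>) + ln (cmod \<rho>)"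
      by (simp add: algebra_simps)
    ultimately show ?case using Suc by simp
  qed simp
  also have "\<dots> \<le> 4 * (K + 1) * (1 + real (b n))"
  proof (cases n)
    case 0
    have "0 \<le> K + 1" using norm_ge_zero[of w] wK by linarith
    then show ?thesis using 0 by simp
  next
    case (Suc m)
    then show ?thesis using dsum[of m] d0[of m] by (simp add: lessThan_Suc_atMost)
  qed
  finally show ?thesis unfolding b_def .
qed

section \<open>Limits superior of rates\<close>

lemma limsup_add_null:
  fixes a b :: "nat \<Rightarrow> real"
  assumes "a \<longlonglongrightarrow> 0"
  shows "limsup (\<lambda>n. ereal (a n + b n)) = limsup (\<lambda>n. ereal (b n))"
proof -
  have "limsup (\<lambda>n. ereal (a n) + ereal (b n)) = ereal 0 + limsup (\<lambda>n. ereal (b n))"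
    using assms by (intro ereal_limsup_lim_add) auto
  then show ?thesis by (simp add: zero_ereal_def[symmetric])
qed

text \<open>Serves to show that a limsup of averages along an orbit does not change when x is
  replaced by \<open>T x\<close>; it is applied to visit counts and to logarithms of
  continuants.\<close>

lemma limsup_rate_shift:
  fixes s t :: "nat \<Rightarrow> real"
  assumes st: "\<And>n. \<bar>s (Suc n) - t n\<bar> \<le> C" and t: "\<And>n. \<bar>t n\<bar> \<le> C * real n"
  shows "limsup (\<lambda>n. ereal (s n / real n)) = limsup (\<lambda>n. ereal (t n / real n))"
proof -
  define \<delta> where "\<delta> n = s (Suc n) / real (Suc n) - t n / real n" for n
  have "\<bar>\<delta> n\<bar> \<le> 2 * C / real (Suc n)" for n
  proof (cases "n = 0")
    \<comment> \<open>Here division by zero gives 0, and the second hypothesis forces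
      \<open>t 0 = 0\<close>.\<close>
    case True
    then show ?thesis using st[of 0] t[of 0] by (simp add: \<delta>_def)
  next
    case False
    have "\<delta> n = (s (Suc n) - t n) / real (Suc n) - (t n / real n) / real (Suc n)"
    proof -
      define u where "u = t n / real n"
      have tu: "t n = u * real n" using False by (simp add: u_def)
      have "u = (u * real n + u) / real (Suc n)"
        by (simp add: field_simps)
      then show ?thesis
        unfolding \<delta>_def u_def [symmetric] by (simp add: tu diff_divide_distrib add_divide_distrib)
    qed
    moreover have "\<bar>(s (Suc n) - t n) / real (Suc n)\<bar> \<le> C / real (Suc n)"
      unfolding abs_divide using st[of n] by (intro frac_le) auto
    moreover have "\<bar>(t n / real n) / real (Suc n)\<bar> \<le> C / real (Suc n)"
    proof -
      have "\<bar>t n / real n\<bar> \<le> C" using t[of n] False by (simp add: field_simps)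
      moreover have "0 \<le> C" using st[of 0] by linarith
      ultimately show ?thesis unfolding abs_divide[of "t n / real n"] by (intro frac_le) auto
    qed
    ultimately have "\<bar>\<delta> n\<bar> \<le> C / real (Suc n) + C / real (Suc n)" by linarith
    then show ?thesis by simp
  qed
  moreover have "(\<lambda>n. 2 * C / real (Suc n)) \<longlonglongrightarrow> 0"
    by (rule LIMSEQ_Suc) (rule lim_const_over_n)
  ultimately have "\<delta> \<longlonglongrightarrow> 0"
    by (intro Lim_null_comparison[of \<delta>]) auto
  then have "limsup (\<lambda>n. ereal (\<delta> n + t n / real n)) = limsup (\<lambda>n. ereal (t n / real n))"
    by (rule limsup_add_null)
  then show ?thesis
    using limsup_shift[of "\<lambda>n. ereal (s n / real n)"] by (simp add: \<delta>_def)
qed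

text \<open>Stated for any index sequence tending to infinity, because the times
  \<open>\<tau> k\<close> constructed below are known only to exceed k, not to increase.\<close>

lemma subseq_limit_le_limsup:
  fixes X :: "nat \<Rightarrow> real"
  assumes "filterlim \<sigma> at_top sequentially" "(\<lambda>i. X (\<sigma> i)) \<longlonglongrightarrow> L"
  shows "ereal L \<le> limsup (\<lambda>n. ereal (X n))"
proof (rule ccontr)
  assume "\<not> ?thesis"
  then obtain y where y: "limsup (\<lambda>n. ereal (X n)) < ereal y" "y < L"
    by (metis ereal_dense2 not_le less_ereal.simps(1))
  have "\<forall>\<^sub>F n in sequentially. ereal (X n) < ereal y"
    using y(1) Limsup_lessD by blast
  then have "\<forall>\<^sub>F i in sequentially. X (\<sigma> i) < y"
    using assms(1) by (auto dest: filterlim_compose eventually_compose_filterlim)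
  moreover have "\<forall>\<^sub>F i in sequentially. y < X (\<sigma> i)"
    using assms(2) y(2) by (rule order_tendstoD)
  ultimately have "\<forall>\<^sub>F i in sequentially. False"
    by eventually_elim simp
  then show False by simp
qed

section \<open>Visits to sets of finite measure\<close>

lemma funpow_measurable:
  assumes "T \<in> measurable M M"
  shows "T ^^ n \<in> measurable M M"
proof (induction n)
  case (Suc n)
  then show ?case using measurable_comp[OF Suc assms] by (simp add: comp_def fun_eq_iff)
qed (simp add: id_def)

lemma measure_preserving_funpow:
  assumes "measure_preserving_transformation M T" "B \<in> sets M"
  shows "emeasure M ((T ^^ n) -` B \<inter> space M) = emeasure M B"
proof (induction n)
  case 0
  then show ?case using assms(2) by (simp add: Int_absorb2 sets.sets_into_space)
next
  case (Suc n)
  have T: "T \<in> measurable M M"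
    using assms(1) by (simp add: measure_preserving_transformation_def)
  have "(T ^^ Suc n) -` B \<inter> space M = T -` ((T ^^ n) -` B \<inter> space M) \<inter> space M"
    using measurable_space[OF T] by (auto simp: funpow_swap1)
  moreover have "(T ^^ n) -` B \<inter> space M \<in> sets M"
    using funpow_measurable[OF T] assms(2) by (rule measurable_sets)
  ultimately show ?case
    using assms(1) Suc by (simp add: measure_preserving_transformation_def del: funpow.simps vimage_Int)
qed

text \<open>Each superlevel set of g is invariant, hence null or conull. The constant is the
  supremum of the levels that g reaches almost everywhere.\<close>

lemma ergodic_invariant_AE_const:
  fixes g :: "'a \<Rightarrow> ereal"
  assumes erg: "ergodic_transformation M T"
    and [measurable]: "g \<in> borel_measurable M"
    and inv: "\<And>x. x \<in> space M \<Longrightarrow> g (T x) = g x"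
  shows "\<exists>c. AE x in M. g x = c"
proof -
  have T: "T \<in> measurable M M"
    using erg by (simp add: ergodic_transformation_def)
  have dich: "(AE x in M. y \<le> g x) \<or> (AE x in M. g x < y)" for y
  proof -
    let ?B = "{x \<in> space M. y \<le> g x}"
    have B: "?B \<in> sets M" by measurable
    have "T -` ?B \<inter> space M = ?B"
      using inv measurable_space[OF T] by auto
    then have "emeasure M ?B = 0 \<or> emeasure M (space M - ?B) = 0"
      using erg B by (simp add: ergodic_transformation_def)
    then show ?thesis
    proof
      assume "emeasure M ?B = 0"
      then have "AE x in M. g x < y" by (subst AE_iff_measurable[OF B]) (auto simp: not_less)
      then show ?thesis ..
    next
      assume *: "emeasure M (space M - ?B) = 0"
      have "space M - ?B \<in> sets M" using B by auto
      from AE_iff_measurable[OF this, of "\<lambda>x. y \<le> g x"] * show ?thesis by auto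
    qed
  qed
  define Y where "Y = {y. AE x in M. y \<le> g x}"
  define c where "c = Sup Y"
  have "- \<infinity> \<in> Y" by (simp add: Y_def)
  then obtain h :: "nat \<Rightarrow> ereal" where h: "range h \<subseteq> Y" "c = (SUP i. h i)"
    using Sup_countable_SUP[of Y] unfolding c_def by blast
  have "AE x in M. \<forall>i. h i \<le> g x"
    using h(1) by (auto simp: Y_def AE_all_countable)
  then have ge: "AE x in M. c \<le> g x"
    by eventually_elim (auto simp: h(2) intro: SUP_least)
  \<comment> \<open>Rational levels keep the number of exceptional null sets countable, and they
    still separate c from any larger value.\<close>
  have "AE x in M. \<forall>q\<in>\<rat>. c < ereal q \<longrightarrow> g x < ereal q"
  proof (subst AE_ball_countable)
    show "countable \<rat>" by (rule countable_rat)
    show "\<forall>q\<in>\<rat>. AE x in M. c < ereal q \<longrightarrow> g x < ereal q"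
    proof
      fix q :: real
      have "AE x in M. g x < ereal q" if "c < ereal q"
      proof -
        have "ereal q \<notin> Y"
          using that Sup_upper[of "ereal q" Y] unfolding c_def by (auto simp: not_le)
        then show ?thesis using dich[of "ereal q"] unfolding Y_def by blast
      qed
      then show "AE x in M. c < ereal q \<longrightarrow> g x < ereal q" by auto
    qed
  qed
  then have "AE x in M. g x = c"
    using ge
  proof eventually_elim
    case (elim x)
    have "g x \<le> c"
    proof (rule ccontr)
      assume "\<not> g x \<le> c"
      then have "c < g x" by simp
      from ereal_dense3[OF this] obtain q where
        "c < ereal (real_of_rat q)" "ereal (real_of_rat q) < g x" by blast
      then show False using elim by (auto dest: less_trans)
    qed
    with elim show ?case by simp
  qed
  then show ?thesis ..
qed

text \<open>Greedy covering: an index at which some window of length at most \<open>N\<close> has density at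
  least \<open>\<lambda>\<close> is removed together with its whole window.\<close>

lemma greedy_window_cover:
  fixes P :: "nat \<Rightarrow> bool" and l :: real and N :: nat
  defines "good \<equiv> \<lambda>i. \<exists>n\<in>{1..N}. l * real n \<le> real (card {j \<in> {i..<i + n}. P j})"
  assumes l: "0 \<le> l"
  shows "l * real (card {i \<in> {0..<K}. good i}) \<le> real (card {j \<in> {0..<K + N}. P j})"
proof -
  \<comment> \<open>A variable left end i lets the induction restart just after a removed window.
    The right side extends to \<open>K + N\<close> because the last window may overrun K.\<close>
  have "l * real (card {k \<in> {i..<K}. good k}) \<le> real (card {j \<in> {i..<K + N}. P j})" if "i \<le> K" for i
    using that
  proof (induction "K - i" arbitrary: i rule: less_induct)
    case less
    show ?case
    proof (cases "i = K")
      case True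
      then show ?thesis by simp
    next
      case False
      then have iK: "i < K" using less.prems by simp
      show ?thesis
      proof (cases "good i")
        case False
        then have "{k \<in> {i..<K}. good k} = {k \<in> {Suc i..<K}. good k}"
          using iK by (auto simp: Suc_le_eq le_less)
        then have "card {k \<in> {i..<K}. good k} = card {k \<in> {Suc i..<K}. good k}" by simp
        moreover have "card {j \<in> {Suc i..<K + N}. P j} \<le> card {j \<in> {i..<K + N}. P j}"
          by (intro card_mono) auto
        moreover have "l * real (card {k \<in> {Suc i..<K}. good k}) \<le> real (card {j \<in> {Suc i..<K + N}. P j})"
          using iK by (intro less.hyps) auto
        ultimately show ?thesis by simp
      next
        case True
        then obtain n where n: "1 \<le> n" "n \<le> N" "l * real n \<le> real (card {j \<in> {i..<i + n}. P j})"
          unfolding good_def by auto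
        show ?thesis
        proof (cases "i + n \<le> K")
          case True
          have "card {k \<in> {i..<K}. good k} \<le> card ({i..<i + n} \<union> {k \<in> {i + n..<K}. good k})"
            by (intro card_mono) auto
          also have "\<dots> \<le> n + card {k \<in> {i + n..<K}. good k}"
            by (rule order_trans[OF card_Un_le]) simp
          finally have "l * real (card {k \<in> {i..<K}. good k}) \<le> l * real (n + card {k \<in> {i + n..<K}. good k})"
            using l by (intro mult_left_mono) auto
          moreover have "l * real (card {k \<in> {i + n..<K}. good k}) \<le> real (card {j \<in> {i + n..<K + N}. P j})"
            using True n(1) iK by (intro less.hyps) auto
          moreover have "card {j \<in> {i..<K + N}. P j} =
              card ({j \<in> {i..<i + n}. P j} \<union> {j \<in> {i + n..<K + N}. P j})"
            using True by (intro arg_cong[of _ _ card]) auto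
          moreover have "\<dots> = card {j \<in> {i..<i + n}. P j} + card {j \<in> {i + n..<K + N}. P j}"
            by (intro card_Un_disjoint) auto
          ultimately show ?thesis using n(3) by (simp add: algebra_simps)
        next
          case False
          \<comment> \<open>The window overruns K, so it alone covers every remaining good
            index.\<close>
          have "card {k \<in> {i..<K}. good k} \<le> card {i..<i + n}"
            using False by (intro card_mono) auto
          then have "l * real (card {k \<in> {i..<K}. good k}) \<le> l * real n"
            using l by (intro mult_left_mono) auto
          moreover have "card {j \<in> {i..<i + n}. P j} \<le> card {j \<in> {i..<K + N}. P j}"
            using iK n(2) by (intro card_mono) auto
          ultimately show ?thesis using n(3) by linarith
        qed
      qed
    qed
  qed
  from this[of 0] show ?thesis by simp
qed

section \<open>Visit counts and the maximal inequality\<close>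

definition visits :: "('a \<Rightarrow> 'a) \<Rightarrow> 'a set \<Rightarrow> 'a \<Rightarrow> nat \<Rightarrow> nat" where
  "visits T A x n = card {j. j < n \<and> (T ^^ j) x \<in> A}"

lemma visits_le: "visits T A x n \<le> n"
  unfolding visits_def using card_mono[of "{..<n}" "{j. j < n \<and> (T ^^ j) x \<in> A}"] by auto

lemma visits_sum: "visits T A x n = (\<Sum>j<n. indicator A ((T ^^ j) x))"
proof -
  have "{j. j < n \<and> (T ^^ j) x \<in> A} = {..<n} \<inter> {j. (T ^^ j) x \<in> A}" by auto
  then show ?thesis
    unfolding visits_def by (simp add: indicator_def sum.If_cases)
qed

lemma visits_Suc: "visits T A x (Suc n) = indicator A x + visits T A (T x) n"
  unfolding visits_sum by (subst sum.lessThan_Suc_shift) (simp add: funpow_swap1)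

lemma nn_integral_visits:
  assumes mp: "measure_preserving_transformation M T" and A: "A \<in> sets M"
  shows "(\<integral>\<^sup>+x. of_nat (visits T A x n) \<partial>M) = of_nat n * emeasure M A"
proof -
  have T: "T \<in> measurable M M"
    using mp by (simp add: measure_preserving_transformation_def)
  have vm: "(T ^^ j) -` A \<inter> space M \<in> sets M" for j
    using funpow_measurable[OF T] A by (rule measurable_sets)
  have "(\<integral>\<^sup>+x. of_nat (visits T A x n) \<partial>M) =
      (\<integral>\<^sup>+x. (\<Sum>j<n. indicator ((T ^^ j) -` A \<inter> space M) x) \<partial>M)"
    by (intro nn_integral_cong) (auto simp: visits_sum indicator_def intro!: sum.cong)
  also have "\<dots> = (\<Sum>j<n. emeasure M ((T ^^ j) -` A \<inter> space M))"
    using vm by (subst nn_integral_sum) auto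
  also have "\<dots> = of_nat n * emeasure M A"
    by (simp add: measure_preserving_funpow[OF mp A])
  finally show ?thesis .
qed

lemma visits_measurable:
  assumes T: "T \<in> measurable M M" and A: "A \<in> sets M"
  shows "(\<lambda>x. visits T A x n) \<in> measurable M (count_space UNIV)"
proof -
  have [measurable]: "(\<lambda>x. (T ^^ j) x) \<in> measurable M M" for j
    using funpow_measurable[OF T] by simp
  note A[measurable]
  show ?thesis unfolding visits_sum indicator_def of_bool_def by measurable
qed

text \<open>The greedy covering is applied along each orbit and integrated. By invariance of the
  measure both integrals are a time length times the measure of a set, and the common factor N
  cancels.\<close>

lemma maximal_inequality:
  fixes l :: real
  assumes mp: "measure_preserving_transformation M T" and A: "A \<in> sets M" and l: "0 < l"
  shows "ennreal l * emeasure M {x \<in> space M. \<exists>n\<ge>1. l * real n \<le> real (visits T A x n)}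
    \<le> 2 * emeasure M A"
proof -
  have T: "T \<in> measurable M M"
    using mp by (simp add: measure_preserving_transformation_def)
  note [measurable] = visits_measurable[OF T A]
  define E where "E N = {x \<in> space M. \<exists>n\<in>{1..N}. l * real n \<le> real (visits T A x n)}" for N
  have E[measurable]: "E N \<in> sets M" for N unfolding E_def by measurable
  have fp: "(T ^^ a) ((T ^^ b) y) = (T ^^ (a + b)) y" for a b y
    by (simp add: funpow_add)
  have win: "card {j \<in> {i..<i + n}. (T ^^ j) x \<in> A} = visits T A ((T ^^ i) x) n" for i n x
  proof -
    have "bij_betw (\<lambda>j. j + i) {j. j < n \<and> (T ^^ j) ((T ^^ i) x) \<in> A}
        {j \<in> {i..<i + n}. (T ^^ j) x \<in> A}"
      by (rule bij_betwI[where g = "\<lambda>j. j - i"]) (auto simp: fp)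
    then show ?thesis unfolding visits_def by (simp add: bij_betw_same_card)
  qed
  have bound: "ennreal l * emeasure M (E N) \<le> 2 * emeasure M A" if "0 < N" for N
  proof -
    \<comment> \<open>N starting points with windows of length at most N see only the first N + N
      steps, whence the factor 2 in the inequality.\<close>
    have pw: "ennreal l * of_nat (visits T (E N) x N) \<le> of_nat (visits T A x (N + N))"
      if x: "x \<in> space M" for x
    proof -
      have Tx: "(T ^^ i) x \<in> space M" for i
        using measurable_space[OF funpow_measurable[OF T] x] .
      have "visits T (E N) x N =
          card {i \<in> {0..<N}. \<exists>n\<in>{1..N}. l * real n \<le> real (visits T A ((T ^^ i) x) n)}"
        unfolding visits_def[of T "E N"] using Tx by (simp add: E_def[of N])
      moreover have "visits T A x (N + N) = card {j \<in> {0..<N + N}. (T ^^ j) x \<in> A}"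
        by (simp add: visits_def)
      ultimately have "l * real (visits T (E N) x N) \<le> real (visits T A x (N + N))"
        using greedy_window_cover[where l = l and N = N and K = N and P = "\<lambda>j. (T ^^ j) x \<in> A"] l
        by (simp only: win)
      then have "ennreal (l * real (visits T (E N) x N)) \<le> ennreal (real (visits T A x (N + N)))"
        by (rule ennreal_leI)
      then show ?thesis using l by (simp add: ennreal_mult ennreal_of_nat_eq_real_of_nat)
    qed
    have "ennreal l * (of_nat N * emeasure M (E N)) = (\<integral>\<^sup>+x. ennreal l * of_nat (visits T (E N) x N) \<partial>M)"
      using visits_measurable[OF T E] by (subst nn_integral_cmult) (auto simp: nn_integral_visits[OF mp E])
    also have "\<dots> \<le> (\<integral>\<^sup>+x. of_nat (visits T A x (N + N)) \<partial>M)"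
      by (intro nn_integral_mono pw)
    also have "\<dots> = of_nat N * (2 * emeasure M A)"
      by (simp add: nn_integral_visits[OF mp A] algebra_simps mult_2)
    finally have "of_nat N * (ennreal l * emeasure M (E N)) \<le> of_nat N * (2 * emeasure M A)"
      by (simp add: ac_simps)
    then show ?thesis using that by (simp add: ennreal_mult_le_mult_iff)
  qed
  have "incseq (\<lambda>N. E (Suc N))"
    unfolding incseq_def E_def by force
  then have "(SUP N. emeasure M (E (Suc N))) = emeasure M (\<Union>N. E (Suc N))"
    by (intro SUP_emeasure_incseq) auto
  moreover have "(\<Union>N. E (Suc N)) = {x \<in> space M. \<exists>n\<ge>1. l * real n \<le> real (visits T A x n)}"
  proof (intro equalityI subsetI)
    fix x assume "x \<in> {x \<in> space M. \<exists>n\<ge>1. l * real n \<le> real (visits T A x n)}"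
    then obtain n where "x \<in> space M" "1 \<le> n" "l * real n \<le> real (visits T A x n)" by blast
    then have "x \<in> E (Suc n)" unfolding E_def by (auto intro!: bexI[of _ n])
    then show "x \<in> (\<Union>N. E (Suc N))" by blast
  qed (auto simp: E_def)
  moreover have "ennreal l * (SUP N. emeasure M (E (Suc N))) \<le> 2 * emeasure M A"
    by (subst SUP_mult_left_ennreal) (intro SUP_least bound, simp)
  ultimately show ?thesis by simp
qed

text \<open>The upper density of visits is invariant, hence almost everywhere a constant. Were it
  above some l > 0, almost every point would lie in the set of the maximal inequality, so infinite
  measure would be bounded by a multiple of the finite measure of A.\<close>

lemma visits_density_zero:
  assumes mp: "measure_preserving_transformation M T" and erg: "ergodic_transformation M T"
    and inf: "emeasure M (space M) = \<infinity>"
    and A: "A \<in> sets M" and fin: "emeasure M A < \<infinity>"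
  shows "AE x in M. (\<lambda>n. real (visits T A x n) / real n) \<longlonglongrightarrow> 0"
proof -
  have T: "T \<in> measurable M M"
    using mp by (simp add: measure_preserving_transformation_def)
  note [measurable] = visits_measurable[OF T A]
  define g where "g x = limsup (\<lambda>n. ereal (real (visits T A x n) / real n))" for x
  have "g (T x) = g x" for x
    unfolding g_def
  proof (rule limsup_rate_shift[symmetric])
    show "\<bar>real (visits T A x (Suc n)) - real (visits T A (T x) n)\<bar> \<le> 1" for n
      unfolding visits_Suc by (simp add: indicator_def)
    show "\<bar>real (visits T A (T x) n)\<bar> \<le> 1 * real n" for n
      using visits_le[of T A "T x" n] by simp
  qed
  moreover have "g \<in> borel_measurable M"
    unfolding g_def by measurable
  ultimately obtain c where c: "AE x in M. g x = c"
    using ergodic_invariant_AE_const[OF erg, of g] by blast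
  have "c \<le> 0"
  proof (rule ccontr)
    assume "\<not> c \<le> 0"
    then obtain l where l: "0 < l" "ereal l < c"
      by (metis ereal_dense2 ereal_less(2) not_le)
    let ?E = "{x \<in> space M. \<exists>n\<ge>1. l * real n \<le> real (visits T A x n)}"
    have E: "?E \<in> sets M" by measurable
    have "AE x in M. x \<in> ?E"
      using c AE_space
    proof eventually_elim
      case (elim x)
      have "\<exists>n\<ge>1. l \<le> real (visits T A x n) / real n"
      proof (rule ccontr)
        assume neg: "\<not> ?thesis"
        have "g x \<le> ereal l"
          unfolding g_def
          by (rule Limsup_bounded, rule eventually_sequentiallyI[of 1]) (use neg in force)
        then show False using elim l by simp
      qed
      then show ?case using elim by (auto simp: field_simps)
    qed
    then have "emeasure M ?E = emeasure M (space M)"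
      using E by (intro emeasure_eq_AE) auto
    then show False
      using maximal_inequality[OF mp A l(1)] inf fin l(1)
      by (auto simp: ennreal_mult_top top_unique ennreal_mult_eq_top_iff)
  qed
  from c show ?thesis
  proof eventually_elim
    case (elim x)
    have "limsup (\<lambda>n. ereal (real (visits T A x n) / real n)) \<le> 0"
      using elim \<open>c \<le> 0\<close> by (simp add: g_def)
    moreover have "0 \<le> liminf (\<lambda>n. ereal (real (visits T A x n) / real n))"
      by (rule Liminf_bounded) auto
    ultimately have "(\<lambda>n. ereal (real (visits T A x n) / real n)) \<longlonglongrightarrow> 0"
      using Liminf_le_Limsup[of sequentially "\<lambda>n. ereal (real (visits T A x n) / real n)"]
      by (intro Liminf_eq_Limsup) (auto intro: antisym)
    then show ?case by (simp add: zero_ereal_def)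
  qed
qed

text \<open>Dominated convergence for indicators, with the integrable majorant
  \<open>indicator A\<close>.\<close>

lemma emeasure_tendsto_0_AE:
  assumes D[measurable]: "\<And>n. D n \<in> sets M" and A[measurable]: "A \<in> sets M" "emeasure M A < \<infinity>"
    and sub: "\<And>n. D n \<subseteq> A" and ae: "AE x in M. \<forall>\<^sub>F n in sequentially. x \<notin> D n"
  shows "(\<lambda>n. emeasure M (D n)) \<longlonglongrightarrow> 0"
proof -
  have "(\<lambda>n. \<integral>\<^sup>+x. indicator (D n) x \<partial>M) \<longlonglongrightarrow> (\<integral>\<^sup>+x. 0 \<partial>M)"
  proof (rule nn_integral_dominated_convergence[where w = "indicator A"])
    show "AE x in M. indicator (D n) x \<le> (indicator A x :: ennreal)" for n
      using sub[of n] by (auto simp: indicator_def)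
    show "AE x in M. (\<lambda>n. indicator (D n) x :: ennreal) \<longlonglongrightarrow> 0"
      using ae
    proof eventually_elim
      case (elim x)
      then have "\<forall>\<^sub>F n in sequentially. (indicator (D n) x :: ennreal) = 0"
        by eventually_elim simp
      then show ?case by (rule tendsto_eventually)
    qed
  qed (use A in auto)
  then show ?thesis by simp
qed

section \<open>The sampling function\<close>

text \<open>The levels of h are the shells of a sparse subsequence \<open>B (m k)\<close>. Density
  zero makes an orbit rarely return to \<open>B (m k)\<close> before \<open>\<tau> k\<close>, and
  the next set is chosen so large that the orbit has not left it by then; what remains of that time
  is spent in shell \<open>Suc k\<close>.\<close>

lemma exists_slowly_changing_level:
  assumes sf: "sigma_finite_measure M" and inf: "emeasure M (space M) = \<infinity>"
    and mp: "measure_preserving_transformation M T" and erg: "ergodic_transformation M T"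
  obtains h :: "'a \<Rightarrow> nat" and \<tau> :: "nat \<Rightarrow> nat"
  where "h \<in> measurable M (count_space UNIV)" "\<And>k. k < \<tau> k"
    "AE x in M. \<forall>\<^sub>F k in sequentially.
       real (card {j. j < \<tau> k \<and> h ((T ^^ j) x) \<noteq> Suc k}) \<le> real (\<tau> k) / real (Suc k)"
proof -
  have T: "T \<in> measurable M M"
    using mp by (simp add: measure_preserving_transformation_def)
  have Tn[measurable]: "(\<lambda>x. (T ^^ j) x) \<in> measurable M M" for j
    using funpow_measurable[OF T] by simp
  obtain B :: "nat \<Rightarrow> 'a set" where rangeB: "range B \<subseteq> sets M" and UB: "(\<Union>i. B i) = space M"
    and finB: "\<And>i. emeasure M (B i) \<noteq> \<infinity>" and incB: "incseq B"
    using sigma_finite_measure.sigma_finite_incseq[OF sf] by metis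
  have B[measurable]: "B i \<in> sets M" for i using rangeB by auto
  have finB': "emeasure M (B i) < \<infinity>" for i
    using finB[of i] unfolding infinity_ennreal_def by (rule top.not_eq_extremum[THEN iffD1])
  note [measurable] = visits_measurable[OF T B]
  have eventually_in_B: "\<forall>\<^sub>F i in sequentially. y \<in> B i" if "y \<in> space M" for y
  proof -
    have "y \<in> (\<Union>i. B i)" using that by (simp only: UB)
    then obtain i where i: "y \<in> B i" by (rule UN_E)
    show ?thesis
      by (rule eventually_sequentiallyI[of i]) (rule subsetD[OF incseqD[OF incB] i])
  qed

  \<comment> \<open>The two ways to fail from a start in \<open>B m\<close>: \<open>D1\<close>
    collects too many returns to \<open>B m\<close> before time n, \<open>D2\<close> an exit from
    \<open>B m'\<close> before time n.\<close>
  define D1 where "D1 m k n = {x \<in> B m. real n / real (Suc k) < real (visits T (B m) x n)}" for m k n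
  define D2 where "D2 m n m' = {x \<in> B m. \<exists>j<n. (T ^^ j) x \<notin> B m'}" for m n m'
  have D1_alt: "D1 m k n = {x \<in> space M. x \<in> B m \<and> real n / real (Suc k) < real (visits T (B m) x n)}" for m k n
    unfolding D1_def using sets.sets_into_space[OF B] by auto
  have D2_alt: "D2 m n m' = {x \<in> space M. x \<in> B m \<and> (\<exists>j<n. (T ^^ j) x \<notin> B m')}" for m n m'
    unfolding D2_def using sets.sets_into_space[OF B] by auto
  have D1[measurable]: "D1 m k n \<in> sets M" for m k n unfolding D1_alt by measurable
  have D2[measurable]: "D2 m n m' \<in> sets M" for m n m' unfolding D2_alt by measurable

  have D1_lim: "(\<lambda>n. emeasure M (D1 m k n)) \<longlonglongrightarrow> 0" for m k
  proof (rule emeasure_tendsto_0_AE[where A = "B m"])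
    show "AE x in M. \<forall>\<^sub>F n in sequentially. x \<notin> D1 m k n"
      using visits_density_zero[OF mp erg inf B finB', of m]
    proof eventually_elim
      case (elim x)
      have "\<forall>\<^sub>F n in sequentially. real (visits T (B m) x n) / real n < 1 / real (Suc k)"
        using elim by (rule order_tendstoD) simp
      then show ?case
        using eventually_gt_at_top[of "0::nat"]
      proof eventually_elim
        case (elim n)
        have "real (visits T (B m) x n) = real (visits T (B m) x n) / real n * real n"
          using elim(2) by simp
        also have "\<dots> \<le> 1 / real (Suc k) * real n"
          using elim(1) by (intro mult_right_mono) auto
        finally show ?case by (simp add: D1_def)
      qed
    qed
  qed (use finB' in \<open>auto simp: D1_def\<close>)
  have D2_lim: "(\<lambda>m'. emeasure M (D2 m n m')) \<longlonglongrightarrow> 0" for m n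
  proof (rule emeasure_tendsto_0_AE[where A = "B m"])
    show "AE x in M. \<forall>\<^sub>F m' in sequentially. x \<notin> D2 m n m'"
      using AE_space
    proof eventually_elim
      case (elim x)
      have "\<forall>\<^sub>F m' in sequentially. \<forall>j\<in>{..<n}. (T ^^ j) x \<in> B m'"
        using elim measurable_space[OF Tn]
        by (intro eventually_ball_finite ballI finite_lessThan eventually_in_B)
      then show ?case by eventually_elim (auto simp: D2_def)
    qed
  qed (use finB' in \<open>auto simp: D2_def\<close>)

  \<comment> \<open>The pair p holds the time and the index of the next set, chosen in this order
    since \<open>D2\<close> depends on the time. The strict inequalities make the times diverge and
    the sets grow; the bounds 1/2^k are summable.\<close>
  define good where "good m k p \<longleftrightarrow> k < fst p \<and> m < snd p \<and>
      emeasure M (D1 m k (fst p) \<union> D2 m (fst p) (snd p)) < ennreal ((1/2) ^ k)" for m k p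
  have "\<exists>p. good m k p" for m k
  proof -
    define e where "e = ennreal ((1/2) ^ Suc k)"
    have e: "0 < e" unfolding e_def by (simp only: ennreal_less_zero_iff) simp
    have ee: "e + e = ennreal ((1/2) ^ k)"
      unfolding e_def by (subst ennreal_plus[symmetric]) auto
    have "\<forall>\<^sub>F n in sequentially. k < n \<and> emeasure M (D1 m k n) < e"
      using order_tendstoD(2)[OF D1_lim e] eventually_gt_at_top by (rule eventually_conj[rotated])
    then obtain n where n: "k < n" "emeasure M (D1 m k n) < e"
      by (auto simp: eventually_sequentially)
    have "\<forall>\<^sub>F m' in sequentially. m < m' \<and> emeasure M (D2 m n m') < e"
      using order_tendstoD(2)[OF D2_lim e] eventually_gt_at_top by (rule eventually_conj[rotated])
    then obtain m' where m': "m < m'" "emeasure M (D2 m n m') < e"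
      by (auto simp: eventually_sequentially)
    have "emeasure M (D1 m k n \<union> D2 m n m') \<le> emeasure M (D1 m k n) + emeasure M (D2 m n m')"
      by (intro emeasure_subadditive D1 D2)
    also have "\<dots> < e + e"
      using n m' by (intro add_strict_mono) auto
    finally have "good m k (n, m')" using n m' ee by (simp add: good_def)
    then show ?thesis ..
  qed
  then obtain p where p: "\<And>m k. good m k (p m k)" by metis
  define m where "m = rec_nat 0 (\<lambda>k a. snd (p a k))"
  have m_Suc: "m (Suc k) = snd (p (m k) k)" for k by (simp add: m_def)
  define \<tau> where "\<tau> k = fst (p (m k) k)" for k
  define Z where "Z k = D1 (m k) k (\<tau> k) \<union> D2 (m k) (\<tau> k) (m (Suc k))" for k
  have Z: "Z k \<in> sets M" for k unfolding Z_def by measurable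
  have Z_small: "emeasure M (Z k) < ennreal ((1/2) ^ k)" for k
    using p[of "m k" k] by (simp add: good_def Z_def \<tau>_def m_Suc)
  have m_mono: "strict_mono m"
    using p by (simp add: good_def strict_mono_Suc_iff m_Suc)
  define h where "h x = (LEAST k. x \<in> B (m k))" for x
  have h_eq: "h y = Suc k" if "y \<in> B (m (Suc k))" "y \<notin> B (m k)" for y k
    unfolding h_def
  proof (rule Least_equality)
    fix i assume "y \<in> B (m i)"
    then show "Suc k \<le> i"
      using that(2) incseqD[OF incB, of "m i" "m k"] strict_mono_leD[OF m_mono, of i k]
      by (metis not_less_eq_eq subsetD)
  qed (use that in auto)
  \<comment> \<open>Borel-Cantelli: almost every point lies in only finitely many of the exceptional
    sets.\<close>
  have AE_notin: "AE x in M. \<forall>\<^sub>F k in sequentially. x \<in> space M - Z k"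
  proof (rule borel_cantelli_AE1)
    show "Z k \<in> sets M" for k by (rule Z)
    show "emeasure M (Z k) < \<infinity>" for k
      using Z_small[of k] by (rule less_trans) simp
    show "summable (\<lambda>k. measure M (Z k))"
    proof (rule summable_comparison_test')
      show "summable (\<lambda>k. (1/2 :: real) ^ k)" by (rule summable_geometric) simp
      show "norm (measure M (Z k)) \<le> (1/2) ^ k" for k
        using enn2real_mono[of "emeasure M (Z k)" "ennreal ((1/2) ^ k)"] Z_small[of k]
        by (simp add: measure_def less_imp_le)
    qed
  qed
  show thesis
  proof
    show "h \<in> measurable M (count_space UNIV)"
      unfolding h_def by measurable
    show "k < \<tau> k" for k using p[of "m k" k] by (simp add: good_def \<tau>_def)
    show "AE x in M. \<forall>\<^sub>F k in sequentially.
       real (card {j. j < \<tau> k \<and> h ((T ^^ j) x) \<noteq> Suc k}) \<le> real (\<tau> k) / real (Suc k)"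
      using AE_notin AE_space
    proof eventually_elim
      case (elim x)
      \<comment> \<open>Avoiding \<open>Z k\<close> says something only about points that already
        lie in \<open>B (m k)\<close>.\<close>
      have "\<forall>\<^sub>F k in sequentially. x \<in> B (m k)"
        using eventually_in_B[OF elim(2)] filterlim_subseq[OF m_mono]
        by (rule eventually_compose_filterlim)
      with elim(1) show ?case
      proof eventually_elim
        case (elim k)
        \<comment> \<open>Before \<open>\<tau> k\<close> the orbit stays in
          \<open>B (m (Suc k))\<close>, so it can miss level \<open>Suc k\<close> only while it is
          in \<open>B (m k)\<close>.\<close>
        have "{j. j < \<tau> k \<and> h ((T ^^ j) x) \<noteq> Suc k} \<subseteq> {j. j < \<tau> k \<and> (T ^^ j) x \<in> B (m k)}"
          using elim h_eq by (auto simp: Z_def D2_def)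
        then have "card {j. j < \<tau> k \<and> h ((T ^^ j) x) \<noteq> Suc k} \<le> visits T (B (m k)) x (\<tau> k)"
          unfolding visits_def by (intro card_mono) auto
        moreover have "real (visits T (B (m k)) x (\<tau> k)) \<le> real (\<tau> k) / real (Suc k)"
          using elim by (auto simp: Z_def D1_def)
        ultimately show ?case by linarith
      qed
    qed
  qed
qed

section \<open>Almost everywhere constant growth rates\<close>

lemma continuant_ln_shift:
  assumes "\<And>k. 3 \<le> cmod (z k)" "\<And>k. cmod (z k) \<le> K"
  shows "\<bar>ln (cmod (continuant z (Suc n))) - ln (cmod (continuant (\<lambda>k. z (Suc k)) n))\<bar> \<le> ln (K + 1)"
proof -
  let ?a = "cmod (continuant z (Suc n))" and ?b = "cmod (continuant (\<lambda>k. z (Suc k)) n)"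
  have ab: "1 \<le> ?b" "?b \<le> ?a" "?a \<le> (K + 1) * ?b"
    using continuant_growth(2)[of "\<lambda>k. z (Suc k)" n] continuant_shift_growth_lower[of z n]
      continuant_shift_growth_upper[of z K n] assms by force+
  have K: "3 \<le> K" using assms[of 0] by linarith
  have "ln ?a \<le> ln ((K + 1) * ?b)" using ab K by (subst ln_le_cancel_iff) auto
  also have "\<dots> = ln (K + 1) + ln ?b" using ab K by (subst ln_mult) auto
  finally have "ln ?a \<le> ln (K + 1) + ln ?b" .
  moreover have "ln ?b \<le> ln ?a" using ab by (subst ln_le_cancel_iff) auto
  ultimately show ?thesis using K by (simp add: abs_le_iff)
qed

text \<open>Iterates the shift estimate down to length 0. The linear bound is needed for the
  invariance of the rates and for their finiteness.\<close>

lemma continuant_ln_bounded: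
  assumes "\<And>k. 3 \<le> cmod (z k)" "\<And>k. cmod (z k) \<le> K"
  shows "\<bar>ln (cmod (continuant z n))\<bar> \<le> ln (K + 1) * real n"
  using assms
proof (induction n arbitrary: z)
  case (Suc n)
  have "\<bar>ln (cmod (continuant (\<lambda>k. z (Suc k)) n))\<bar> \<le> ln (K + 1) * real n"
    using Suc.prems by (intro Suc.IH)
  moreover have "\<bar>ln (cmod (continuant z (Suc n))) - ln (cmod (continuant (\<lambda>k. z (Suc k)) n))\<bar> \<le> ln (K + 1)"
    using Suc.prems by (rule continuant_ln_shift)
  ultimately show ?case by (simp add: algebra_simps abs_le_iff)
qed simp

text \<open>The upper left entry dominates the other three, so the operator norm lies between its
  modulus and 4 times that, and the rates differ by at most (ln 4)/n from n = 2 on.\<close>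

lemma log_growth_rate_continuant:
  fixes T :: "'a \<Rightarrow> 'a" and f :: "'a \<Rightarrow> real" and E :: complex and x :: 'a
  defines "z \<equiv> \<lambda>k. E - complex_of_real (f ((T ^^ k) x))"
  assumes z3: "\<And>k. 3 \<le> cmod (z k)"
  shows "(\<lambda>n. log_growth_rate T f E x n - ln (cmod (continuant z n)) / real n) \<longlonglongrightarrow> 0"
proof (rule Lim_null_comparison)
  show "(\<lambda>n. ln 4 / real n) \<longlonglongrightarrow> 0" by (rule lim_const_over_n)
  have "norm (log_growth_rate T f E x n - ln (cmod (continuant z n)) / real n) \<le> ln 4 / real n"
    if n2: "2 \<le> n" for n
  proof -
    obtain m where m: "n = Suc (Suc m)"
      using n2 by (metis add_2_eq_Suc le_Suc_ex)
    let ?A = "transfer_cocycle T f E n x" and ?p = "cmod (continuant z n)"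
    let ?z' = "\<lambda>k. z (Suc k)"
    have A: "?A = vector [vector [continuant z (Suc (Suc m)), - continuant ?z' (Suc m)],
        vector [continuant z (Suc m), - continuant ?z' m]]"
      unfolding m z_def by (rule transfer_cocycle_continuant)
    have p1: "1 \<le> ?p" using z3 by (rule continuant_growth)
    have "2 * cmod (continuant ?z' (Suc m)) \<le> cmod (continuant z (Suc (Suc m)))"
      using z3 by (rule continuant_shift_growth_lower)
    moreover have "2 * cmod (continuant ?z' m) \<le> cmod (continuant z (Suc m))"
      using z3 by (rule continuant_shift_growth_lower)
    moreover have "2 * cmod (continuant z (Suc m)) \<le> cmod (continuant z (Suc (Suc m)))"
      using z3 by (rule continuant_growth)
    moreover note norm_ge_zero[of "continuant ?z' (Suc m)"] norm_ge_zero[of "continuant ?z' m"]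
      norm_ge_zero[of "continuant z (Suc m)"]
    ultimately have "cmod (continuant ?z' (Suc m)) \<le> ?p" "cmod (continuant ?z' m) \<le> ?p"
      "cmod (continuant z (Suc m)) \<le> ?p"
      unfolding m by linarith+
    then have "\<forall>i j. cmod (?A $ i $ j) \<le> ?p"
      unfolding A by (simp add: forall_2 m del: continuant.simps)
    then have up: "onorm ((*v) ?A) \<le> 4 * ?p"
      using onorm_matrix_vector_2_bounds(2) by blast
    have low: "?p \<le> onorm ((*v) ?A)"
    proof -
      have "?A $ 1 $ 1 = continuant z n" by (simp only: A) (simp add: m)
      then show ?thesis using onorm_matrix_vector_2_bounds(1)[of ?A] by simp
    qed
    have "ln ?p \<le> ln (onorm ((*v) ?A))"
      using low p1 by (subst ln_le_cancel_iff) auto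
    moreover have "ln (onorm ((*v) ?A)) \<le> ln (4 * ?p)"
      using up low p1 by (subst ln_le_cancel_iff) auto
    moreover have "ln (4 * ?p) = ln 4 + ln ?p" using p1 by (subst ln_mult) auto
    ultimately have "\<bar>ln (onorm ((*v) ?A)) - ln ?p\<bar> \<le> ln 4" by linarith
    then have "\<bar>ln (onorm ((*v) ?A)) - ln ?p\<bar> / real n \<le> ln 4 / real n"
      by (intro divide_right_mono) auto
    then show ?thesis
      by (simp add: log_growth_rate_def diff_divide_distrib [symmetric] del: transfer_cocycle.simps)
  qed
  then show "\<forall>\<^sub>F n in sequentially.
      norm (log_growth_rate T f E x n - ln (cmod (continuant z n)) / real n) \<le> ln 4 / real n"
    by (intro eventually_sequentiallyI[of 2])
qed

lemma abs_limsup_rate_le: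
  fixes a :: "nat \<Rightarrow> real"
  assumes "\<And>n. \<bar>a n\<bar> \<le> C"
  shows "\<bar>limsup (\<lambda>n. ereal (a n))\<bar> \<le> ereal C"
proof -
  have le: "- C \<le> a n" "a n \<le> C" for n
    using assms[of n] by (auto simp: abs_le_iff)
  have "limsup (\<lambda>n. ereal (a n)) \<le> ereal C"
    using le by (intro Limsup_bounded) auto
  moreover have "ereal (- C) \<le> limsup (\<lambda>n. ereal (a n))"
  proof -
    have "ereal (- C) \<le> liminf (\<lambda>n. ereal (a n))"
      using le by (intro Liminf_bounded) auto
    also have "\<dots> \<le> limsup (\<lambda>n. ereal (a n))" by (rule Liminf_le_Limsup) simp
    finally show ?thesis .
  qed
  ultimately show ?thesis by (cases "limsup (\<lambda>n. ereal (a n))") auto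
qed

text \<open>The sign \<open>\<sigma>\<close> treats both exponents at once, since a liminf is minus
  the limsup of the negated sequence.\<close>

lemma continuant_rate_AE_const:
  fixes f :: "'a \<Rightarrow> real" and \<sigma> :: real
  assumes erg: "ergodic_transformation M T"
    and f: "f \<in> borel_measurable M"
    and fb: "\<And>x. 3 \<le> cmod (E - complex_of_real (f x))" "\<And>x. cmod (E - complex_of_real (f x)) \<le> K"
    and \<sigma>: "\<bar>\<sigma>\<bar> = 1"
  defines "a \<equiv> \<lambda>x n. ln (cmod (continuant (\<lambda>k. E - complex_of_real (f ((T ^^ k) x))) n))"
  obtains L :: real where "AE x in M. limsup (\<lambda>n. ereal (\<sigma> * a x n / real n)) = ereal L"
proof -
  define z where "z x k = E - complex_of_real (f ((T ^^ k) x))" for x k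
  have a: "a x n = ln (cmod (continuant (z x) n))" for x n
    unfolding a_def z_def ..
  have z3: "3 \<le> cmod (z x k)" and zK: "cmod (z x k) \<le> K" for x k
    using fb by (simp_all add: z_def)
  have zT: "z (T x) = (\<lambda>k. z x (Suc k))" for x
    by (simp add: z_def funpow_swap1 fun_eq_iff)
  define g where "g x = limsup (\<lambda>n. ereal (\<sigma> * a x n / real n))" for x
  have T: "T \<in> measurable M M"
    using erg by (simp add: ergodic_transformation_def)
  have Tn[measurable]: "(\<lambda>x. (T ^^ j) x) \<in> measurable M M" for j
    using funpow_measurable[OF T] by simp
  note f[measurable]
  have z_meas[measurable]: "(\<lambda>x. z x k) \<in> borel_measurable M" for k
    unfolding z_def by measurable
  have cont_meas[measurable]: "(\<lambda>x. continuant (z x) n) \<in> borel_measurable M" for n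
  proof (induction n rule: less_induct)
    case (less n)
    consider "n = 0" | "n = 1" | m where "n = Suc (Suc m)"
      by (metis One_nat_def not0_implies_Suc)
    then show ?case
    proof cases
      case 3
      have [measurable]: "(\<lambda>x. continuant (z x) (Suc m)) \<in> borel_measurable M"
        "(\<lambda>x. continuant (z x) m) \<in> borel_measurable M"
        using less[of "Suc m"] less[of m] 3 by auto
      show ?thesis unfolding 3 continuant.simps by measurable
    qed simp_all
  qed
  have g_meas: "g \<in> borel_measurable M"
    unfolding g_def a by measurable
  have "g (T x) = g x" for x
    unfolding g_def
  proof (rule limsup_rate_shift[symmetric])
    show "\<bar>\<sigma> * a x (Suc n) - \<sigma> * a (T x) n\<bar> \<le> ln (K + 1)" for n
      using continuant_ln_shift[of "z x" K n] z3 zK \<sigma>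
      unfolding a zT by (simp add: abs_mult right_diff_distrib [symmetric])
    show "\<bar>\<sigma> * a (T x) n\<bar> \<le> ln (K + 1) * real n" for n
      using continuant_ln_bounded[of "z (T x)" K n] z3 zK \<sigma>
      unfolding a by (simp add: abs_mult)
  qed
  then obtain c where c: "AE x in M. g x = c"
    using ergodic_invariant_AE_const[OF erg g_meas] by blast
  have bounded: "\<bar>g x\<bar> \<le> ereal (ln (K + 1))" for x
    unfolding g_def
  proof (rule abs_limsup_rate_le)
    fix n
    have "\<bar>\<sigma> * a x n\<bar> \<le> ln (K + 1) * real n"
      using continuant_ln_bounded[of "z x" K n] z3 zK \<sigma>
      unfolding a by (simp add: abs_mult)
    moreover have "3 \<le> K" using z3[of x 0] zK[of x 0] by linarith
    ultimately show "\<bar>\<sigma> * a x n / real n\<bar> \<le> ln (K + 1)"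
      by (cases "n = 0") (auto simp: abs_divide pos_divide_le_eq)
  qed
  \<comment> \<open>The uniform bound on g rules out an infinite c wherever
    \<open>g x = c\<close>.\<close>
  have "AE x in M. g x = ereal (real_of_ereal c)"
    using c
  proof eventually_elim
    case (elim x)
    then show ?case using bounded[of x] by (cases c) auto
  qed
  then show thesis using that unfolding g_def by blast
qed

section \<open>Separation of the two exponents\<close>

theorem proposition6p4:
  fixes \<mu> :: "'a measure" and T :: "'a \<Rightarrow> 'a"
  assumes "sigma_finite_measure \<mu>"
    and "emeasure \<mu> (space \<mu>) = \<infinity>"
    and "conservative_transformation \<mu> T"
    and "invertible_transformation \<mu> T"
    and "ergodic_transformation \<mu> T"
    and "measure_preserving_transformation \<mu> T"
  shows "\<exists>M\<^sub>0>0. \<forall>M::real. M \<ge> M\<^sub>0 \<longrightarrow>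
    (\<exists>f :: 'a \<Rightarrow> real. f \<in> borel_measurable \<mu> \<and> bounded (f ` space \<mu>) \<and>
      (\<forall>E::complex. cmod E > M \<longrightarrow>
        (\<exists>Lu Ll :: real.
           is_upper_Lyapunov_exponent \<mu> T f E Lu \<and>
           is_lower_Lyapunov_exponent \<mu> T f E Ll \<and>
           Lu > Ll)))"
proof -
  obtain h :: "'a \<Rightarrow> nat" and \<tau> where h[measurable]: "h \<in> measurable \<mu> (count_space UNIV)"
    and \<tau>: "\<And>k. k < \<tau> k"
    and slow: "AE x in \<mu>. \<forall>\<^sub>F k in sequentially.
       real (card {j. j < \<tau> k \<and> h ((T ^^ j) x) \<noteq> Suc k}) \<le> real (\<tau> k) / real (Suc k)"
    using exists_slowly_changing_level[OF assms(1,2,6,5)] by blast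
  \<comment> \<open>Two values would not suffice for every E: for E = 1/2 + iy, the numbers E and E
    - 1 are reflections of each other in the imaginary axis and have expanding roots of equal
    modulus.\<close>
  define f where "f x = real (h x mod 3)" for x
  have f[measurable]: "f \<in> borel_measurable \<mu>"
    unfolding f_def by measurable
  have f_bounds: "0 \<le> f x" "f x \<le> 2" for x
  proof -
    have "h x mod 3 \<le> 2" by simp
    then show "0 \<le> f x" "f x \<le> 2" unfolding f_def by linarith+
  qed
  have "bounded (f ` space \<mu>)"
    using f_bounds by (intro boundedI[of _ 2]) auto
  \<comment> \<open>Since f takes values in [0, 2], the threshold 5 = 3 + 2 ensures that every E -
    f(x) has modulus at least 3.\<close>
  moreover have "\<exists>Lu Ll :: real. is_upper_Lyapunov_exponent \<mu> T f E Lu \<and>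
      is_lower_Lyapunov_exponent \<mu> T f E Ll \<and> Lu > Ll" if E: "5 < cmod E" for E :: complex
  proof -
    define K where "K = cmod E + 2"
    have shift: "3 \<le> cmod (E - complex_of_real r)" "cmod (E - complex_of_real r) \<le> K"
      if "0 \<le> r" "r \<le> 2" for r
      using norm_triangle_ineq2[of E "complex_of_real r"] norm_triangle_ineq4[of E "complex_of_real r"]
        that E by (auto simp: K_def)
    define z where "z x k = E - complex_of_real (f ((T ^^ k) x))" for x k
    have z3: "3 \<le> cmod (z x k)" and zK: "cmod (z x k) \<le> K" for x k
      using shift f_bounds by (simp_all add: z_def)
    define a where "a x n = ln (cmod (continuant (z x) n))" for x n
    obtain U where U: "AE x in \<mu>. limsup (\<lambda>n. ereal (1 * a x n / real n)) = ereal U"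
      using continuant_rate_AE_const[OF assms(5) f, where E = E and K = K and \<sigma> = "1"] shift f_bounds
      unfolding a_def z_def by fastforce
    \<comment> \<open>V is the limsup of the negated rates, so the lower exponent will be
      -V.\<close>
    obtain V where V: "AE x in \<mu>. limsup (\<lambda>n. ereal (- 1 * a x n / real n)) = ereal V"
      using continuant_rate_AE_const[OF assms(5) f, where E = E and K = K and \<sigma> = "- 1"] shift f_bounds
      unfolding a_def z_def by fastforce

    have rate: "(\<lambda>n. log_growth_rate T f E x n - a x n / real n) \<longlonglongrightarrow> 0" for x
      using log_growth_rate_continuant[of E f T x] z3 unfolding a_def z_def by simp
    have upper: "is_upper_Lyapunov_exponent \<mu> T f E U"
      unfolding is_upper_Lyapunov_exponent_def using U
    proof eventually_elim
      case (elim x)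
      then show ?case using limsup_add_null[OF rate[of x], of "\<lambda>n. a x n / real n"] by simp
    qed
    have lower: "is_lower_Lyapunov_exponent \<mu> T f E (- V)"
      unfolding is_lower_Lyapunov_exponent_def using V
    proof eventually_elim
      case (elim x)
      have "(\<lambda>n. - (log_growth_rate T f E x n - a x n / real n)) \<longlonglongrightarrow> 0"
        using tendsto_minus[OF rate[of x]] by simp
      from limsup_add_null[OF this, of "\<lambda>n. - a x n / real n"]
      have "limsup (\<lambda>n. - ereal (log_growth_rate T f E x n)) = ereal V"
        using elim by simp
      then show ?case
        unfolding ereal_Limsup_uminus by (simp add: ereal_uminus_eq_reorder)
    qed

    have "\<exists>\<rho>. \<forall>c<3. \<rho> c + 1 / \<rho> c = E - of_nat c \<and> 2 \<le> cmod (\<rho> c)"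
    proof -
      have "\<exists>r. c < 3 \<longrightarrow> r + 1 / r = E - of_nat c \<and> 2 \<le> cmod r" for c :: nat
      proof (cases "c < 3")
        case True
        then have "3 \<le> cmod (E - of_nat c)" using shift(1)[of "real c"] by simp
        then show ?thesis using exists_expanding_root by metis
      qed simp
      then show ?thesis by metis
    qed
    then obtain \<rho> where root: "\<And>c. c < 3 \<Longrightarrow> \<rho> c + 1 / \<rho> c = E - of_nat c"
      and \<rho>2: "\<And>c. c < 3 \<Longrightarrow> 2 \<le> cmod (\<rho> c)" by blast
    obtain c d where cd: "c < 3" "d < 3" "cmod (\<rho> c) < cmod (\<rho> d)"
      using expanding_roots_not_all_equal[of \<rho> E] root \<rho>2 by blast

    \<comment> \<open>U and V are constants, so a single point outside the exceptional sets suffices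
      to compare them; it exists because the space is not null.\<close>
    have "\<not> (AE x in \<mu>. False)"
      using assms(2) by (auto simp: AE_iff_measurable[OF sets.top])
    then obtain x where xU: "limsup (\<lambda>n. ereal (1 * a x n / real n)) = ereal U"
      and xV: "limsup (\<lambda>n. ereal (- 1 * a x n / real n)) = ereal V"
      and xslow: "\<forall>\<^sub>F k in sequentially.
        real (card {j. j < \<tau> k \<and> h ((T ^^ j) x) \<noteq> Suc k}) \<le> real (\<tau> k) / real (Suc k)"
      using AE_conjI[OF U AE_conjI[OF V slow]] by (smt (verit) eventually_mono)
    have sub: "\<exists>s. filterlim s at_top sequentially \<and> (\<lambda>i. a x (s i) / real (s i)) \<longlonglongrightarrow> ln (cmod (\<rho> c))"
      if c: "c < 3" for c
    proof (intro exI conjI)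
      \<comment> \<open>The orbit sits in level \<open>Suc (\<kappa> i)\<close> = 3(i + 1) + c,
        which is congruent to c modulo 3, so f equals c there.\<close>
      define \<kappa> where "\<kappa> i = 3 * i + c + 2" for i
      define s where "s i = \<tau> (\<kappa> i)" for i
      have \<kappa>_lim: "filterlim \<kappa> at_top sequentially"
        unfolding \<kappa>_def by (rule filterlim_subseq) (simp add: strict_mono_def)
      show "filterlim (\<lambda>i. \<tau> (3 * i + c + 2)) at_top sequentially"
      proof (rule filterlim_at_top_mono[OF \<kappa>_lim])
        show "\<forall>\<^sub>F i in sequentially. \<kappa> i \<le> \<tau> (3 * i + c + 2)"
          using \<tau> by (simp add: \<kappa>_def less_imp_le)
      qed
      have "\<forall>\<^sub>F i in sequentially.
          real (card {j. j < s i \<and> h ((T ^^ j) x) \<noteq> Suc (\<kappa> i)}) \<le> real (s i) / real (Suc (\<kappa> i))"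
        unfolding s_def using xslow \<kappa>_lim by (rule eventually_compose_filterlim)
      then have "\<forall>\<^sub>F i in sequentially.
          norm (a x (s i) / real (s i) - ln (cmod (\<rho> c))) \<le> 8 * (K + 1) / real (Suc i)"
      proof eventually_elim
        case (elim i)
        have si: "\<kappa> i < s i" "Suc i \<le> \<kappa> i" using \<tau> by (simp_all add: s_def \<kappa>_def)
        have K0: "0 \<le> K + 1" by (simp add: K_def)
        have "Suc (\<kappa> i) mod 3 = c" using c by (simp add: \<kappa>_def)
        then have "{j. j < s i \<and> z x j \<noteq> E - of_nat c} \<subseteq> {j. j < s i \<and> h ((T ^^ j) x) \<noteq> Suc (\<kappa> i)}"
          by (auto simp: z_def f_def)
        then have "card {j. j < s i \<and> z x j \<noteq> E - of_nat c} \<le> card {j. j < s i \<and> h ((T ^^ j) x) \<noteq> Suc (\<kappa> i)}"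
          by (intro card_mono) auto
        then have few: "real (card {j. j < s i \<and> z x j \<noteq> E - of_nat c}) \<le> real (s i) / real (Suc (\<kappa> i))"
          using elim by linarith
        have "\<bar>a x (s i) - real (s i) * ln (cmod (\<rho> c))\<bar>
            \<le> 4 * (K + 1) * (1 + real (card {j. j < s i \<and> z x j \<noteq> E - of_nat c}))"
          unfolding a_def
          using continuant_ln_growth[of "z x" K "\<rho> c" "E - of_nat c" "s i"] z3 zK
            root[OF c] \<rho>2[OF c] shift(2)[of "real c"] c by simp
        \<comment> \<open>Both the constant 1 and the count of bad indices are at most
          \<open>s i / Suc i\<close>, because \<open>Suc i \<le> \<kappa> i < s i\<close>. After
          division by \<open>s i\<close> the error tends to 0.\<close>
        also have "\<dots> \<le> 4 * (K + 1) * (real (s i) / real (Suc i) + real (s i) / real (Suc i))"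
        proof (intro mult_left_mono add_mono)
          show "1 \<le> real (s i) / real (Suc i)" using si by simp
          show "real (card {j. j < s i \<and> z x j \<noteq> E - of_nat c}) \<le> real (s i) / real (Suc i)"
            by (rule order_trans[OF few]) (intro divide_left_mono, use si in auto)
        qed (use K0 in simp)
        finally have "\<bar>a x (s i) - real (s i) * ln (cmod (\<rho> c))\<bar> \<le> 8 * (K + 1) / real (Suc i) * real (s i)"
          by (simp add: algebra_simps)
        then have "\<bar>a x (s i) - real (s i) * ln (cmod (\<rho> c))\<bar> / real (s i) \<le> 8 * (K + 1) / real (Suc i)"
          using si by (simp add: pos_divide_le_eq)
        moreover have "a x (s i) / real (s i) - ln (cmod (\<rho> c)) = (a x (s i) - real (s i) * ln (cmod (\<rho> c))) / real (s i)"
          using si by (simp add: diff_divide_distrib)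
        ultimately show ?case by simp
      qed
      moreover have "(\<lambda>i. 8 * (K + 1) / real (Suc i)) \<longlonglongrightarrow> 0"
        by (rule LIMSEQ_Suc) (rule lim_const_over_n)
      ultimately have "(\<lambda>i. a x (s i) / real (s i) - ln (cmod (\<rho> c))) \<longlonglongrightarrow> 0"
        by (rule Lim_null_comparison)
      then show "(\<lambda>i. a x (\<tau> (3 * i + c + 2)) / real (\<tau> (3 * i + c + 2))) \<longlonglongrightarrow> ln (cmod (\<rho> c))"
        by (simp add: LIM_zero_iff s_def \<kappa>_def)
    qed
    \<comment> \<open>At this point the rates accumulate at the logarithms of both moduli: the
      larger bounds U from below, the smaller bounds -V from above.\<close>
    have "ln (cmod (\<rho> d)) \<le> U"
      using sub[OF cd(2)] subseq_limit_le_limsup[of _ "\<lambda>n. a x n / real n"] xU by auto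
    moreover have "- ln (cmod (\<rho> c)) \<le> V"
    proof -
      obtain s where s: "filterlim s at_top sequentially"
        "(\<lambda>i. a x (s i) / real (s i)) \<longlonglongrightarrow> ln (cmod (\<rho> c))"
        using sub[OF cd(1)] by blast
      have "(\<lambda>i. - 1 * a x (s i) / real (s i)) \<longlonglongrightarrow> - ln (cmod (\<rho> c))"
        using tendsto_minus[OF s(2)] by simp
      from subseq_limit_le_limsup[of s "\<lambda>n. - 1 * a x n / real n", OF s(1) this] xV show ?thesis
        by simp
    qed
    moreover have "ln (cmod (\<rho> c)) < ln (cmod (\<rho> d))"
      using cd \<rho>2[OF cd(1)] by (subst ln_less_cancel_iff) auto
    ultimately have "- V < U" by linarith
    then show ?thesis using upper lower by blast
  qed
  ultimately show ?thesis
    \<comment> \<open>The same f serves every \<open>M \<ge> 5\<close>, as it was built without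
      reference to E or M.\<close>
    using f by (intro exI[of _ 5]) (auto intro!: exI[of _ f])
qed

end
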